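(* Let $u:(0,\infty)\to\mathbb{R}$ be a utility function such that $u(1)=0$, let $k\ge1$ be an integer and let $p\in S_k$. Then $$H^{A}_{-u}(p)=H_{u_{1/k}}(p)=-u\!\left(e^{-h_u(p)}\right),$$ where $u_{1/k}:(0,\infty)\to\mathbb{R}$ is given by $u_{1/k}(x):=u(x/k)$.
   Context: A utility function is a strictly concave, strictly increasing, continuously differentiable function $u:(0,\infty)\to\mathbb{R}$ such that $\lim_{x\searrow 0}u'(x)=\infty$ and $\lim_{x\nearrow\infty}u'(x)=0$. Put $u(0):=\lim_{x\searrow0}u(x)\in[-\infty,\infty)$. The convention $\infty\cdot 0=-\infty\cdot 0=0$ is used. $S_k=\{p\in\mathbb{R}^k:\ p_i\ge 0,\ \sum_{i=1}^k p_i=1\}$; $p_{(k)}\in S_k$ is the uniform vector, $(p_{(k)})_i=1/k$. Arimoto's entropy: for a non-negative continuously differentiable function $f:(0,1]\to\mathbb{R}$ with $f(1)=0$, $H^A_f(p):=\inf_{w\in S_k}\sum_{i=1}^k f(w_i)p_i$ for $p\in S_k$. For $f=-u$ this means the restriction of $-u$ to $(0,1]$, with $f(0):=-u(0)\in(-\infty,\infty]$. Discrete $u$-entropy: $h_u(p):=-\ln u^{-1}(n_u(p))$, where $n_u(p):=\sup_{w\in S_k}\sum_{i=1}^k u(w_i)p_i$. Friedman–Huang–Sandow $U$-entropy of $p\in S_k$ for a utility function $v$: $H_v(p):=v(k)-v(1)-D_v(p\parallel p_{(k)})$, where $$D_v(p\parallel p_{(k)}):=\sup_{w\in S_k}\sum_{i=1}^k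 v(kw_i)p_i-v(1).$$ *)

theory Defs
  imports "HOL-Analysis.Analysis"
begin

definition strictly_concave_on :: "'a::real_vector set \<Rightarrow> ('a \<Rightarrow> real) \<Rightarrow> bool" where
  "strictly_concave_on S f \<longleftrightarrow> convex S \<and>
     (\<forall>x\<in>S. \<forall>y\<in>S. \<forall>t. x \<noteq> y \<and> 0 < t \<and> t < 1 \<longrightarrow>
        (1 - t) * f x + t * f y < f ((1 - t) *\<^sub>R x + t *\<^sub>R y))"

(* Functions on (0,\<infinity>) are total functions on the reals of which only the
   values at positive arguments are relevant. *)
definition utility_function :: "(real \<Rightarrow> real) \<Rightarrow> bool" where
  "utility_function u \<longleftrightarrow>
     strictly_concave_on {0<..} u \<and>
     strict_mono_on {0<..} u \<and>
     (\<forall>x>0. u differentiable (at x)) \<and>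
     continuous_on {0<..} (deriv u) \<and>
     filterlim (deriv u) at_top (at_right 0) \<and>
     (deriv u \<longlongrightarrow> 0) at_top"

(* u on [0,\<infinity>), with u(0) the right-hand limit, which may be -\<infinity>.
   Meaningful for nonnegative arguments only. *)
definition ext0 :: "(real \<Rightarrow> real) \<Rightarrow> real \<Rightarrow> ereal" where
  "ext0 u x = (if x = 0 then Lim (at_right 0) (\<lambda>y. ereal (u y)) else ereal (u x))"

lemma tendsto_ext0:
  assumes "utility_function u"
  shows "((\<lambda>x. ereal (u x)) \<longlongrightarrow> ext0 u 0) (at_right 0)"
proof -
  have sm: "strict_mono_on {0<..} u"
    using assms by (simp add: utility_function_def)
  have "((\<lambda>x. ereal (u x)) \<longlongrightarrow> (INF x\<in>{0<..}. ereal (u x))) (at_right 0)"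
  proof (rule decreasing_tendsto)
    show "\<forall>\<^sub>F x in at_right 0. (INF x\<in>{0<..}. ereal (u x)) \<le> ereal (u x)"
      by (auto simp: eventually_at_right_field intro!: INF_lower exI[of _ 1])
  next
    fix c assume "(INF x\<in>{0<..}. ereal (u x)) < c"
    then obtain y where y: "y > 0" "ereal (u y) < c"
      by (auto simp: INF_less_iff)
    have "ereal (u x) < c" if "0 < x" "x < y" for x
    proof -
      have "u x < u y"
        using sm that y by (auto simp: strict_mono_on_def)
      then show ?thesis
        using y by (metis ereal_less_eq(3) le_less_trans less_imp_le)
    qed
    then show "\<forall>\<^sub>F x in at_right 0. ereal (u x) < c"
      using y by (auto simp: eventually_at_right_field)
  qed
  then show ?thesis
    by (simp add: ext0_def tendsto_Lim)
qed

(* The dimension k is CARD('k). *)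
definition prob_simplex :: "(real ^ 'k) set" where
  "prob_simplex = {p. (\<forall>i. 0 \<le> p $ i) \<and> (\<Sum>i\<in>UNIV. p $ i) = 1}"

(* f is a function on [0,1]; its value at 0 may be \<infinity>.
   Here and below, products in ereal satisfy \<infinity> * 0 = -\<infinity> * 0 = 0. *)
definition arimoto_entropy :: "(real \<Rightarrow> ereal) \<Rightarrow> real ^ 'k \<Rightarrow> ereal" where
  "arimoto_entropy f p = (INF w\<in>prob_simplex. \<Sum>i\<in>UNIV. f (w $ i) * ereal (p $ i))"

definition max_expected_utility :: "(real \<Rightarrow> real) \<Rightarrow> real ^ 'k \<Rightarrow> ereal" where
  "max_expected_utility u p =
     (SUP w\<in>prob_simplex. \<Sum>i\<in>UNIV. ext0 u (w $ i) * ereal (p $ i))"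

(* The inverse is that of u as an injective map from (0,\<infinity>) to the extended
   reals, as the supremum is an extended real. *)
definition u_entropy :: "(real \<Rightarrow> real) \<Rightarrow> real ^ 'k \<Rightarrow> real" where
  "u_entropy u p =
     - ln (the_inv_into {0<..} (\<lambda>x. ereal (u x)) (max_expected_utility u p))"

(* The divergence of p from the uniform vector. *)
definition fhs_divergence_unif :: "(real \<Rightarrow> real) \<Rightarrow> real ^ 'k \<Rightarrow> ereal" where
  "fhs_divergence_unif v p =
     (SUP w\<in>prob_simplex. \<Sum>i\<in>UNIV. ext0 v (real CARD('k) * w $ i) * ereal (p $ i))
       - ereal (v 1)"

definition fhs_entropy :: "(real \<Rightarrow> real) \<Rightarrow> real ^ 'k \<Rightarrow> ereal" where
  "fhs_entropy v p = ereal (v (real CARD('k))) - ereal (v 1) - fhs_divergence_unif v p"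

end

theory Submission
  imports Defs
begin

text \<open>All three quantities are functions of the maximal expected utility \<open>M\<close>: both entropies equal
  \<open>- M\<close>, since rescaling by \<open>k\<close> turns \<open>u\<^bsub>1/k\<^esub> (k w)\<close> into \<open>u w\<close>. As \<open>M\<close> lies between \<open>u (1/k)\<close>
  (the value at the uniform vector) and \<open>u 1\<close>, it is attained by \<open>u\<close> on \<open>[1/k, 1]\<close>, so that
  \<open>u (u\<^sup>-\<^sup>1 M) = M\<close>.\<close>

text \<open>Negation distributes over a sum of extended reals as long as \<open>\<infinity>\<close>
  and \<open>-\<infinity>\<close> do not meet; excluding \<open>\<infinity>\<close> from the terms
  ensures this.\<close>

lemma sum_uminus_ereal:
  fixes f :: "'a \<Rightarrow> ereal"
  assumes "\<And>i. i \<in> A \<Longrightarrow> f i \<noteq> \<infinity>"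
  shows "(\<Sum>i\<in>A. - f i) = - (\<Sum>i\<in>A. f i)"
  using assms
proof (induction A rule: infinite_finite_induct)
  case (insert a A)
  then have "(\<Sum>i\<in>A. f i) \<noteq> \<infinity>" "f a \<noteq> \<infinity>"
    by (auto simp: sum_Pinfty)
  then have "- (f a + (\<Sum>i\<in>A. f i)) = - f a + - (\<Sum>i\<in>A. f i)"
    by (cases "f a"; cases "\<Sum>i\<in>A. f i") auto
  with insert show ?case
    by simp
qed auto

lemma prob_simplex_nonneg: "w \<in> prob_simplex \<Longrightarrow> 0 \<le> w $ i"
  by (simp add: prob_simplex_def)

lemma prob_simplex_sum: "w \<in> prob_simplex \<Longrightarrow> (\<Sum>i\<in>UNIV. w $ i) = 1"
  by (simp add: prob_simplex_def)

lemma prob_simplex_le_1: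
  assumes "w \<in> prob_simplex"
  shows "w $ i \<le> 1"
proof -
  have "w $ i \<le> (\<Sum>i\<in>UNIV. w $ i)"
    by (rule member_le_sum) (use assms in \<open>auto simp: prob_simplex_nonneg\<close>)
  then show ?thesis
    using assms by (simp add: prob_simplex_sum)
qed

lemma uniform_in_prob_simplex: "(\<chi> i. 1 / real CARD('k)) \<in> (prob_simplex :: (real ^ 'k) set)"
  by (simp add: prob_simplex_def)

lemma utility_function_mono:
  assumes "utility_function u" "0 < x" "x \<le> y"
  shows "u x \<le> u y"
  using assms unfolding utility_function_def strict_mono_on_def
  by (cases "x = y") (auto intro: less_imp_le)

lemma utility_function_inj_on:
  assumes "utility_function u"
  shows "inj_on (\<lambda>x. ereal (u x)) {0<..}"
  using assms strict_mono_on_imp_inj_on[of "{0<..}" u]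
  by (auto simp: utility_function_def inj_on_def)

lemma utility_function_continuous_on:
  assumes "utility_function u"
  shows "continuous_on {0<..} u"
  using assms unfolding utility_function_def
  by (intro continuous_at_imp_continuous_on) (auto intro: differentiable_imp_continuous_within)

text \<open>At \<open>x = 0\<close>, the values of \<open>u\<close> on \<open>(0, y)\<close> are
  bounded by \<open>u y\<close>, and the bound passes to the right-hand limit.\<close>

lemma ext0_mono:
  assumes u: "utility_function u" and "0 \<le> x" "x \<le> y" "0 < y"
  shows "ext0 u x \<le> ereal (u y)"
proof (cases "x = 0")
  case True
  have "\<forall>\<^sub>F z in at_right 0. ereal (u z) \<le> ereal (u y)"
    using utility_function_mono[OF u] \<open>0 < y\<close>
    by (auto simp: eventually_at_right_field intro!: exI[of _ y])
  then show ?thesis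
    using True tendsto_upperbound[OF tendsto_ext0[OF u]] by simp
next
  case False
  then show ?thesis
    using assms utility_function_mono[OF u] by (simp add: ext0_def)
qed

lemma ext0_not_PInf:
  assumes "utility_function u" "0 \<le> x"
  shows "ext0 u x \<noteq> \<infinity>"
  using ext0_mono[of u x "x + 1"] assms by auto

text \<open>Only the value at 0 needs an argument: \<open>y / c\<close> tends to 0 from the right as
  \<open>y\<close> does, so both limits agree.\<close>

lemma ext0_scale:
  assumes u: "utility_function u" and c: "0 < c"
  shows "ext0 (\<lambda>x. u (x / c)) (c * x) = ext0 u x"
proof (cases "x = 0")
  case True
  have "filterlim (\<lambda>y. y / c) (at_right 0) (at_right 0)"
    unfolding filterlim_at using c
    by (auto simp: eventually_at_right_field intro!: exI[of _ 1] tendsto_eq_intros)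
  from filterlim_compose[OF tendsto_ext0[OF u] this]
  have "((\<lambda>y. ereal (u (y / c))) \<longlongrightarrow> ext0 u 0) (at_right 0)" .
  then have "Lim (at_right 0) (\<lambda>y. ereal (u (y / c))) = ext0 u 0"
    by (intro tendsto_Lim) auto
  then show ?thesis
    using True by (simp add: ext0_def)
next
  case False
  then show ?thesis
    using c by (simp add: ext0_def)
qed

text \<open>This makes \<open>u\<close> invertible at the maximal expected utility, which a priori
  is only an extended real.\<close>

lemma max_expected_utility_eq_utility:
  fixes p :: "real ^ 'k"
  assumes u: "utility_function u" and p: "p \<in> prob_simplex"
  obtains x where "0 < x" "max_expected_utility u p = ereal (u x)"
proof -
  let ?M = "max_expected_utility u p" and ?k = "real CARD('k)"
  \<comment> \<open>The weights \<open>p $ i\<close> sum to 1; both bounds on \<open>?M\<close> rest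
    on this.\<close>
  have const: "(\<Sum>i\<in>UNIV. ereal c * ereal (p $ i)) = ereal c" for c
    using prob_simplex_sum[OF p] by (simp flip: sum_distrib_left)
  have "?M \<le> ereal (u 1)"
    unfolding max_expected_utility_def
  proof (rule SUP_least)
    fix w :: "real ^ 'k" assume w: "w \<in> prob_simplex"
    have "(\<Sum>i\<in>UNIV. ext0 u (w $ i) * ereal (p $ i)) \<le> (\<Sum>i\<in>UNIV. ereal (u 1) * ereal (p $ i))"
      using ext0_mono[OF u] prob_simplex_nonneg[OF w] prob_simplex_le_1[OF w]
        prob_simplex_nonneg[OF p]
      by (intro sum_mono ereal_mult_right_mono) auto
    then show "(\<Sum>i\<in>UNIV. ext0 u (w $ i) * ereal (p $ i)) \<le> ereal (u 1)"
      by (simp only: const)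
  qed
  moreover have "ereal (u (1 / ?k)) \<le> ?M"
    unfolding max_expected_utility_def
    by (rule SUP_upper2[OF uniform_in_prob_simplex])
      (use const[of "u (1 / ?k)"] in \<open>simp add: ext0_def\<close>)
  \<comment> \<open>The bounds are real numbers, so \<open>?M\<close> is neither
    \<open>\<infinity>\<close> nor \<open>-\<infinity>\<close>.\<close>
  ultimately obtain m where m: "?M = ereal m" "u (1 / ?k) \<le> m" "m \<le> u 1"
    by (cases ?M) auto
  have k: "0 < 1 / ?k"
    by simp
  have "\<exists>x\<ge>1 / ?k. x \<le> 1 \<and> u x = m"
  proof (rule IVT')
    \<comment> \<open>The interval stays away from 0, where \<open>u\<close> need not be
      continuous.\<close>
    have "{1 / ?k..1} \<subseteq> {0<..}"
      using k by (meson atLeastAtMost_iff greaterThan_iff less_le_trans subsetI)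
    then show "continuous_on {1 / ?k..1} u"
      by (rule continuous_on_subset[OF utility_function_continuous_on[OF u]])
    show "1 / ?k \<le> 1"
      by simp
  qed (use m in auto)
  then obtain x where "1 / ?k \<le> x" "u x = m"
    by auto
  then show ?thesis
    using that[of x] m(1) less_le_trans[OF k] by simp
qed

text \<open>The sign moves out of each sum, and an infimum of negatives is the negative of the
  supremum.\<close>

lemma arimoto_entropy_eq:
  fixes p :: "real ^ 'k"
  assumes u: "utility_function u" and p: "p \<in> prob_simplex"
  shows "arimoto_entropy (\<lambda>x. - ext0 u x) p = - max_expected_utility u p"
proof -
  have "(\<Sum>i\<in>UNIV. - ext0 u (w $ i) * ereal (p $ i)) =
      - (\<Sum>i\<in>UNIV. ext0 u (w $ i) * ereal (p $ i))"
    if w: "w \<in> prob_simplex" for w :: "real ^ 'k"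
  proof -
    \<comment> \<open>A factor \<open>-\<infinity>\<close> times a nonnegative weight gives
      \<open>-\<infinity>\<close> or, by convention, 0.\<close>
    have "ext0 u (w $ i) * ereal (p $ i) \<noteq> \<infinity>" for i
      using ext0_not_PInf[OF u prob_simplex_nonneg[OF w]] prob_simplex_nonneg[OF p, of i]
      by simp
    then show ?thesis
      by (simp add: sum_uminus_ereal)
  qed
  then show ?thesis
    by (simp add: arimoto_entropy_def max_expected_utility_def flip: ereal_INF_uminus_eq)
qed

text \<open>For \<open>v x = u (x / k)\<close> the supremum in the divergence is the maximal
  expected utility of \<open>u\<close>, \<open>v k\<close> is \<open>u 1\<close>, and the two
  occurrences of \<open>v 1\<close> cancel.\<close>

lemma fhs_entropy_scaled_eq:
  fixes p :: "real ^ 'k"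
  assumes u: "utility_function u" and p: "p \<in> prob_simplex"
  shows "fhs_entropy (\<lambda>x. u (x / real CARD('k))) p = ereal (u 1) - max_expected_utility u p"
proof -
  \<comment> \<open>A real value for the supremum reduces the cancellation to real
    arithmetic.\<close>
  obtain x where x: "max_expected_utility u p = ereal (u x)"
    using max_expected_utility_eq_utility[OF u p] .
  show ?thesis
    using x unfolding fhs_entropy_def fhs_divergence_unif_def max_expected_utility_def
    by (simp add: ext0_scale[OF u])
qed

theorem proposition4p8:
  fixes u :: "real \<Rightarrow> real" and p :: "real ^ 'k"
  assumes "utility_function u"
    and "u 1 = 0"
    and "p \<in> prob_simplex"
  shows "arimoto_entropy (\<lambda>x. - ext0 u x) p = fhs_entropy (\<lambda>x. u (x / real CARD('k))) p
    \<and> fhs_entropy (\<lambda>x. u (x / real CARD('k))) p = ereal (- u (exp (- u_entropy u p)))"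
proof -
  obtain x where x: "0 < x" "max_expected_utility u p = ereal (u x)"
    using max_expected_utility_eq_utility[OF assms(1,3)] .
  have "the_inv_into {0<..} (\<lambda>x. ereal (u x)) (ereal (u x)) = x"
    using the_inv_into_f_f[OF utility_function_inj_on[OF assms(1)]] x(1) by simp
  then have "exp (- u_entropy u p) = x"
    using x by (simp add: u_entropy_def)
  \<comment> \<open>As \<open>u 1 = 0\<close>, both entropies equal \<open>- u x\<close>.\<close>
  then show ?thesis
    using x(2) assms by (simp add: arimoto_entropy_eq fhs_entropy_scaled_eq)
qed

end
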